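(* Let $f:\mathbb{R}^n\to\mathbb{R}$ be differentiable, convex and $L$-smooth. For $k\ge0$ set $w_k=\frac{2}{k+2}$, and let $(x_k)$, $(v_k)$, $(y_k)$ be sequences in $\mathbb{R}^n$ satisfying, for all $k\ge0$, $$y_k=(1-w_k)x_k+w_kv_k,$$ $$x_{k+1}-x_k=w_k(v_k-x_k)-\frac1L\nabla f(y_k),\qquad v_{k+1}-v_k=-\frac{1}{w_kL}\nabla f(y_k).$$ Then $(x_k,y_k)$ follows Nesterov's accelerated gradient method for the convex case, i.e. for all $k\ge0$, $$x_{k+1}=y_k-\frac1L\nabla f(y_k),\qquad y_{k+1}=x_{k+1}+\frac{k}{k+3}(x_{k+1}-x_k).$$
   Context: $f$ is $L$-smooth if $f(y)-f(x)+\nabla f(x)\cdot(x-y)\le \frac L2|x-y|^2$ for all $x,y$. *)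

theory Defs
  imports "HOL-Analysis.Analysis"
begin

text \<open>The gradient is determined only at points where the function is differentiable;
  elsewhere the definite description is unspecified.\<close>

definition gradient :: "(real ^ 'n \<Rightarrow> real) \<Rightarrow> real ^ 'n \<Rightarrow> real ^ 'n"
  where "gradient f x = (THE g. GDERIV f x :> g)"

definition L_smooth :: "real \<Rightarrow> (real ^ 'n \<Rightarrow> real) \<Rightarrow> bool"
  where "L_smooth L f \<longleftrightarrow>
    (\<forall>x y. f y - f x + gradient f x \<bullet> (x - y) \<le> L / 2 * (norm (x - y))\<^sup>2)"

lemma GDERIV_gradient:
  fixes f :: "real ^ 'n \<Rightarrow> real"
  assumes "f differentiable (at x)"
  shows "GDERIV f x :> gradient f x"
proof -
  obtain f' where f': "(f has_derivative f') (at x)"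
    using assms by (auto simp: differentiable_def)
  then have lin: "linear f'"
    by (simp add: has_derivative_linear)
  have eq: "f' = (\<lambda>h. h \<bullet> adjoint f' 1)"
    by (rule ext) (simp add: adjoint_works[OF lin])
  have D: "GDERIV f x :> adjoint f' 1"
    unfolding gderiv_def by (rule has_derivative_subst[OF f' eq])
  have "g = adjoint f' 1" if "GDERIV f x :> g" for g
  proof -
    have "(\<lambda>h. h \<bullet> g) = (\<lambda>h. h \<bullet> adjoint f' 1)"
      using that D unfolding gderiv_def by (rule has_derivative_unique)
    then have "\<forall>h. h \<bullet> g = h \<bullet> adjoint f' 1"
      by (intro allI) (rule fun_cong)
    then show ?thesis
      by (simp only: vector_eq_ldot)
  qed
  then show ?thesis
    unfolding gradient_def using D by (rule theI[rotated])
qed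

end

theory Submission
  imports Defs
begin

text \<open>The identity is pure algebra. Since \<open>y k - x k\<close> equals \<open>w k\<close>
  times \<open>v k - x k\<close>, the \<open>x\<close> update is a gradient step from
  \<open>y k\<close>. Scaled by \<open>w k\<close>, the \<open>v\<close> update has the same
  gradient term as the \<open>x\<close> update, so the gradient cancels and \<open>v (Suc k)\<close>
  lies on the line through \<open>x k\<close> and \<open>x (Suc k)\<close>, at parameter
  \<open>1 / w k\<close>. Averaging it with \<open>x (Suc k)\<close> therefore yields a pure
  momentum term.\<close>

theorem proposition4p1:
  fixes f :: "real ^ 'n \<Rightarrow> real"
    and L :: real
    and w :: "nat \<Rightarrow> real"
    and x v y :: "nat \<Rightarrow> real ^ 'n"
  assumes f_diff: "\<forall>z. f differentiable (at z)"
    and f_convex: "convex_on UNIV f"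
    and L_pos: "L > 0"
    and f_smooth: "L_smooth L f"
    and w_eq: "\<forall>k. w k = 2 / (real k + 2)"
    and y_eq: "\<forall>k. y k = (1 - w k) *\<^sub>R x k + w k *\<^sub>R v k"
    and x_step: "\<forall>k. x (Suc k) - x k = w k *\<^sub>R (v k - x k) - (1 / L) *\<^sub>R gradient f (y k)"
    and v_step: "\<forall>k. v (Suc k) - v k = - ((1 / (w k * L)) *\<^sub>R gradient f (y k))"
  shows "\<forall>k. x (Suc k) = y k - (1 / L) *\<^sub>R gradient f (y k) \<and>
             y (Suc k) = x (Suc k) + (real k / (real k + 3)) *\<^sub>R (x (Suc k) - x k)"
proof (intro allI conjI)
  fix k
  define g where "g = (1 / L) *\<^sub>R gradient f (y k)"
  have w_pos: "w k > 0"
    by (simp add: w_eq)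
  have dx: "x (Suc k) - x k = w k *\<^sub>R (v k - x k) - g"
    using x_step unfolding g_def by blast
  have yk: "w k *\<^sub>R (v k - x k) = y k - x k"
    unfolding y_eq[rule_format, of k] by (simp add: algebra_simps)
  have "x (Suc k) = y k - g"
    using dx unfolding yk by (simp add: algebra_simps)
  then show "x (Suc k) = y k - (1 / L) *\<^sub>R gradient f (y k)"
    by (simp add: g_def)
  have dv: "w k *\<^sub>R (v (Suc k) - v k) = - g"
    using w_pos by (simp add: v_step g_def)
  \<comment> \<open>Splitting at \<open>v k\<close> exposes the right-hand side of
    \<open>dx\<close>, which eliminates \<open>g\<close>.\<close>
  have "w k *\<^sub>R (v (Suc k) - x k) = w k *\<^sub>R (v (Suc k) - v k) + w k *\<^sub>R (v k - x k)"
    by (simp flip: scaleR_add_right)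
  then have dvx: "w k *\<^sub>R (v (Suc k) - x k) = x (Suc k) - x k"
    unfolding dv dx by simp
  have "(1 / w k) *\<^sub>R (x (Suc k) - x k) = v (Suc k) - x k"
    using w_pos by (simp flip: dvx)
  then have v_diff: "v (Suc k) - x (Suc k) = (1 / w k - 1) *\<^sub>R (x (Suc k) - x k)"
    by (simp add: scaleR_diff_left)
  have "y (Suc k) = x (Suc k) + w (Suc k) *\<^sub>R (v (Suc k) - x (Suc k))"
    unfolding y_eq[rule_format, of "Suc k"] by (simp add: algebra_simps)
  also have "\<dots> = x (Suc k) + (w (Suc k) * (1 / w k - 1)) *\<^sub>R (x (Suc k) - x k)"
    by (simp add: v_diff)
  \<comment> \<open>Here \<open>1 / w k - 1\<close> is \<open>k / 2\<close> and
    \<open>w (Suc k)\<close> is \<open>2 / (k + 3)\<close>; this is where the specific choice of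
    weights enters.\<close>
  also have "w (Suc k) * (1 / w k - 1) = real k / (real k + 3)"
    by (simp add: w_eq field_simps)
  finally show "y (Suc k) = x (Suc k) + (real k / (real k + 3)) *\<^sub>R (x (Suc k) - x k)" .
qed

end
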